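(* Let $k,m,r$ be integers with $1<k\leq m$ and $1\le r<k$. Then the element $h_{k,m}$ of Houghton's group $\mathcal{H}_2$ satisfies $\kappa_r^{\mathcal S}(h_{k,m})>0$.
   Context: Houghton's group $\mathcal{H}_2\cong S_\infty\rtimes\mathbb{Z}$ is the group of permutations of $\mathbb{Z}\smallsetminus\{0\}$ generated by the translation $s$ (which sends each nonzero integer to the next nonzero integer, so $-1\mapsto 1$) and the transposition $\sigma$ exchanging $-1$ and $1$; here $S_\infty$ is the group of finitely supported permutations of $\mathbb{Z}\smallsetminus\{0\}$ and $\mathbb{Z}=\langle s\rangle$. The standard generating set is $\{s,\sigma\}$. For $1\le k\le m$, $h_{k,m}\in S_\infty\subset\mathcal{H}_2$ is the permutation that exchanges $l$ and $-l$ for every $k\leq l\leq m$ and fixes all other nonzero integers. Let $|x|$ denote word length with respect to $\{s,s^{-1},\sigma\}$ and $S_r=\{w\in\mathcal{H}_2: |w|=r\}$. For $g\neq e$, the spherical comparison curvature of radius $r$ is $$\kappa_r^{\mathcal S}(g)=\frac{|g|-\frac{1}{|S_r|}\sum_{w\in S_r}|w^{-1}gw|}{|g|}.$$ *)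

theory Defs
  imports Complex_Main "HOL-Algebra.Bij" "HOL-Algebra.Generated_Groups"
    "HOL-Combinatorics.Transposition"
begin

section \<open>Word length and spherical comparison curvature\<close>

definition word_prod :: "('a, 'b) monoid_scheme \<Rightarrow> 'a list \<Rightarrow> 'a" where
  "word_prod G ws = foldr (\<lambda>x y. x \<otimes>\<^bsub>G\<^esub> y) ws \<one>\<^bsub>G\<^esub>"

text \<open>The length is meaningful for elements of the group generated by \<open>T\<close>
  (see \<open>ex_word\<close> below).\<close>

definition word_length :: "('a, 'b) monoid_scheme \<Rightarrow> 'a set \<Rightarrow> 'a \<Rightarrow> nat" where
  "word_length G T g =
     (LEAST n. \<exists>ws. length ws = n \<and> set ws \<subseteq> T \<union> m_inv G ` T \<and> word_prod G ws = g)"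

definition word_sphere :: "('a, 'b) monoid_scheme \<Rightarrow> 'a set \<Rightarrow> nat \<Rightarrow> 'a set" where
  "word_sphere G T r = {w \<in> carrier G. word_length G T w = r}"

definition spherical_curvature :: "('a, 'b) monoid_scheme \<Rightarrow> 'a set \<Rightarrow> nat \<Rightarrow> 'a \<Rightarrow> real" where
  "spherical_curvature G T r g =
     (real (word_length G T g)
        - (1 / real (card (word_sphere G T r))) *
          (\<Sum>w\<in>word_sphere G T r. real (word_length G T (inv\<^bsub>G\<^esub> w \<otimes>\<^bsub>G\<^esub> g \<otimes>\<^bsub>G\<^esub> w))))
     / real (word_length G T g)"

section \<open>Houghton's group on two rays\<close>

abbreviation nonzero_ints :: "int set" where
  "nonzero_ints \<equiv> UNIV - {0}"

text \<open>As \<open>BijGroup\<close> consists of extensional functions, all permutations below are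
  restricted to the nonzero integers.\<close>

definition houghton_s :: "int \<Rightarrow> int" where
  "houghton_s = (\<lambda>x\<in>nonzero_ints. if x = -1 then 1 else x + 1)"

definition houghton_sigma :: "int \<Rightarrow> int" where
  "houghton_sigma = (\<lambda>x\<in>nonzero_ints. transpose (-1) 1 x)"

definition houghton_gens :: "(int \<Rightarrow> int) set" where
  "houghton_gens = {houghton_s, houghton_sigma}"

definition houghton2 :: "(int \<Rightarrow> int) monoid" where
  "houghton2 = BijGroup nonzero_ints
     \<lparr>carrier := generate (BijGroup nonzero_ints) houghton_gens\<rparr>"

definition houghton_h :: "int \<Rightarrow> int \<Rightarrow> int \<Rightarrow> int" where
  "houghton_h k m = (\<lambda>x\<in>nonzero_ints. if k \<le> \<bar>x\<bar> \<and> \<bar>x\<bar> \<le> m then - x else x)"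

section \<open>Well-formedness\<close>

lemma word_prod_append:
  assumes "group G" "set us \<subseteq> carrier G" "set vs \<subseteq> carrier G"
  shows "word_prod G us \<in> carrier G \<and> word_prod G (us @ vs) = word_prod G us \<otimes>\<^bsub>G\<^esub> word_prod G vs"
proof -
  interpret group G by fact
  have c: "set vs \<subseteq> carrier G \<Longrightarrow> word_prod G vs \<in> carrier G" for vs
    by (induction vs) (auto simp: word_prod_def)
  show ?thesis using assms(2,3)
  proof (induction us)
    case Nil
    then show ?case using c by (auto simp: word_prod_def)
  next
    case (Cons a us)
    then show ?case using c[of vs] by (auto simp: word_prod_def m_assoc)
  qed
qed

lemma ex_word:
  assumes "group G" "T \<subseteq> carrier G" "g \<in> generate G T"
  shows "\<exists>ws. set ws \<subseteq> T \<union> m_inv G ` T \<and> word_prod G ws = g"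
proof -
  interpret group G by fact
  have sub: "T \<union> m_inv G ` T \<subseteq> carrier G" using assms(2) by auto
  show ?thesis using assms(3)
  proof (induction rule: generate.induct)
    case one
    show ?case by (intro exI[of _ "[]"]) (simp add: word_prod_def)
  next
    case (incl h)
    then show ?case using assms(2) by (intro exI[of _ "[h]"]) (auto simp: word_prod_def)
  next
    case (inv h)
    then show ?case using assms(2)
      by (intro exI[of _ "[inv\<^bsub>G\<^esub> h]"]) (auto simp: word_prod_def)
  next
    case (eng h1 h2)
    then obtain us vs where "set us \<subseteq> T \<union> m_inv G ` T" "word_prod G us = h1"
      "set vs \<subseteq> T \<union> m_inv G ` T" "word_prod G vs = h2" by blast
    then show ?case using word_prod_append[OF assms(1), of us vs] sub
      by (intro exI[of _ "us @ vs"]) auto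
  qed
qed

lemma finite_word_sphere:
  assumes "group G" "T \<subseteq> carrier G" "generate G T = carrier G" "finite T"
  shows "finite (word_sphere G T r)"
proof -
  let ?L = "{ws. set ws \<subseteq> T \<union> m_inv G ` T \<and> length ws = r}"
  have "word_sphere G T r \<subseteq> word_prod G ` ?L"
  proof
    fix w assume w: "w \<in> word_sphere G T r"
    then have "\<exists>n ws. length ws = n \<and> set ws \<subseteq> T \<union> m_inv G ` T \<and> word_prod G ws = w"
      using ex_word[OF assms(1,2), of w] assms(3) by (auto simp: word_sphere_def)
    from LeastI_ex[OF this] show "w \<in> word_prod G ` ?L"
      using w by (auto simp: word_sphere_def word_length_def[symmetric])
  qed
  moreover have "finite ?L" using assms(4) by (intro finite_lists_length_eq) auto
  ultimately show ?thesis by (meson finite_imageI finite_subset)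
qed

lemma houghton_s_Bij: "houghton_s \<in> Bij nonzero_ints"
proof -
  have "bij_betw houghton_s nonzero_ints nonzero_ints"
    by (rule bij_betw_byWitness[where f' = "\<lambda>x. if x = 1 then -1 else x - 1"])
       (auto simp: houghton_s_def)
  then show ?thesis by (simp add: Bij_def houghton_s_def)
qed

lemma transpose_Bij:
  assumes "a \<in> S" "b \<in> S"
  shows "restrict (transpose a b) S \<in> Bij S"
proof -
  have "bij_betw (restrict (transpose a b) S) S S"
    using assms by (intro bij_betw_byWitness[where f' = "transpose a b"])
      (auto simp: transpose_def)
  then show ?thesis by (simp add: Bij_def)
qed

lemma houghton_gens_subset: "houghton_gens \<subseteq> carrier (BijGroup nonzero_ints)"
  using houghton_s_Bij transpose_Bij[of "-1" nonzero_ints 1]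
  by (auto simp: houghton_gens_def houghton_sigma_def BijGroup_def)

lemma group_houghton2: "group houghton2"
  unfolding houghton2_def
  by (intro subgroup.subgroup_is_group group.generate_is_subgroup group_BijGroup
      houghton_gens_subset)

lemma generate_houghton2: "generate houghton2 houghton_gens = carrier houghton2"
  unfolding houghton2_def
  using group.generate_consistent[OF group_BijGroup _
      group.generate_is_subgroup[OF group_BijGroup houghton_gens_subset]]
  by (auto intro: generate.incl)

lemma finite_houghton_sphere: "finite (word_sphere houghton2 houghton_gens r)"
  by (rule finite_word_sphere[OF group_houghton2 _ generate_houghton2])
     (auto simp: generate_houghton2[symmetric] houghton_gens_def intro: generate.incl)

lemma houghton_h_in_carrier:
  assumes "1 \<le> k"
  shows "houghton_h k m \<in> carrier houghton2"
proof -
  let ?Z = nonzero_ints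
  let ?B = "BijGroup ?Z"
  define H where "H = generate ?B houghton_gens"
  define t where "t a b = restrict (transpose a b) ?Z" for a b
  have t_apply: "t a b x = (if x = a then b else if x = b then a else x)" if "x \<noteq> 0" for a b x
    using that by (simp add: t_def transpose_def)
  interpret B: group ?B by (rule group_BijGroup)
  have sg: "subgroup H ?B" unfolding H_def by (rule B.generate_is_subgroup[OF houghton_gens_subset])
  have B: "f \<in> Bij ?Z" if "f \<in> H" for f
    using subgroup.mem_carrier[OF sg that] by (simp add: BijGroup_def)
  have mult: "f \<otimes>\<^bsub>?B\<^esub> g = compose ?Z f g" if "f \<in> Bij ?Z" "g \<in> Bij ?Z" for f g
    using that by (simp add: BijGroup_def)
  have comp: "compose ?Z f g \<in> H" if "f \<in> H" "g \<in> H" for f g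
    using subgroup.m_closed[OF sg that] unfolding mult[OF B[OF that(1)] B[OF that(2)]] .
  have conj: "t (f a) (f b) \<in> H \<longleftrightarrow> t a b \<in> H" if f: "f \<in> H" and ab: "a \<in> ?Z" "b \<in> ?Z" for f a b
  proof -
    have fB: "f \<in> Bij ?Z" by (rule B[OF f])
    then have inj: "inj_on f ?Z" and im: "x \<in> ?Z \<Longrightarrow> f x \<in> ?Z" for x
      by (auto simp: Bij_def bij_betw_def)
    have tB: "t a b \<in> Bij ?Z" "t (f a) (f b) \<in> Bij ?Z"
      using ab im unfolding t_def by (blast intro: transpose_Bij)+
    have "compose ?Z f (t a b) = compose ?Z (t (f a) (f b)) f"
    proof
      fix x
      show "compose ?Z f (t a b) x = compose ?Z (t (f a) (f b)) f x"
      proof (cases "x \<in> ?Z")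
        case True
        then have "f x = f a \<longleftrightarrow> x = a" "f x = f b \<longleftrightarrow> x = b"
          using inj ab by (auto simp del: Diff_iff dest: inj_onD)
        with True show ?thesis
          using im[OF True] by (simp add: compose_eq t_apply)
      qed (simp add: compose_def)
    qed
    then have eq: "f \<otimes>\<^bsub>?B\<^esub> t a b = t (f a) (f b) \<otimes>\<^bsub>?B\<^esub> f"
      using fB tB by (simp only: mult)
    have c: "f \<in> carrier ?B" "t a b \<in> carrier ?B" "t (f a) (f b) \<in> carrier ?B"
      using fB tB by (auto simp: BijGroup_def)
    have "t a b = inv\<^bsub>?B\<^esub> f \<otimes>\<^bsub>?B\<^esub> (t (f a) (f b) \<otimes>\<^bsub>?B\<^esub> f)"
      using c by (simp add: eq[symmetric] B.m_assoc[symmetric])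
    moreover have "t (f a) (f b) = f \<otimes>\<^bsub>?B\<^esub> t a b \<otimes>\<^bsub>?B\<^esub> inv\<^bsub>?B\<^esub> f"
      using c by (simp add: eq B.m_assoc)
    ultimately show ?thesis
      using f subgroup.m_closed[OF sg] subgroup.m_inv_closed[OF sg] by metis
  qed
  have s: "houghton_s \<in> H" and t11: "t (-1) 1 \<in> H"
    by (auto simp: H_def t_def houghton_gens_def houghton_sigma_def intro: generate.incl)
  have up: "t (int n + 1) (int n + 2) \<in> H" for n
  proof (induction n)
    case 0
    then show ?case using conj[OF s, of "-1" 1] t11 by (simp add: houghton_s_def)
  next
    case (Suc n)
    then show ?case using conj[OF s, of "int n + 1" "int n + 2"]
      by (simp add: houghton_s_def algebra_simps)
  qed
  have down: "t (-2 - int n) (-1 - int n) \<in> H" for n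
  proof (induction n)
    case 0
    then show ?case using conj[OF s, of "-2" "-1"] t11 by (simp add: houghton_s_def)
  next
    case (Suc n)
    have e: "-2 - int (Suc n) = -3 - int n" "-1 - int (Suc n) = -2 - int n" by simp_all
    show ?case unfolding e using Suc conj[OF s, of "-3 - int n" "-2 - int n"]
      by (simp add: houghton_s_def)
  qed
  have flip: "t (-1 - int n) (int n + 1) \<in> H" for n
  proof (induction n)
    case 0
    then show ?case using t11 by simp
  next
    case (Suc n)
    have 1: "t (-1 - int n) (int n + 2) \<in> H"
      using conj[OF up[of n], of "-1 - int n" "int n + 1"] Suc by (simp add: t_apply)
    have e: "-1 - int (Suc n) = -2 - int n" "int (Suc n) + 1 = int n + 2" by simp_all
    show ?case unfolding e
      using 1 conj[OF down[of n], of "-1 - int n" "int n + 2"]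
      by (simp add: t_apply)
  qed
  have "houghton_h k (k - 1 + int n) \<in> H" for n
  proof (induction n)
    case 0
    have "houghton_h k (k - 1) = \<one>\<^bsub>?B\<^esub>" by (auto simp: houghton_h_def BijGroup_def fun_eq_iff)
    then show ?case using subgroup.one_closed[OF sg] by simp
  next
    case (Suc n)
    have "t (- (k + int n)) (k + int n) \<in> H"
      using flip[of "nat (k + int n - 1)"] assms by (simp add: algebra_simps)
    from comp[OF Suc this]
    have "compose ?Z (houghton_h k (k - 1 + int n)) (t (- (k + int n)) (k + int n)) \<in> H" .
    also have "compose ?Z (houghton_h k (k - 1 + int n)) (t (- (k + int n)) (k + int n))
        = houghton_h k (k - 1 + int (Suc n))"
    proof
      fix x
      show "compose ?Z (houghton_h k (k - 1 + int n)) (t (- (k + int n)) (k + int n)) x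
          = houghton_h k (k - 1 + int (Suc n)) x"
        using assms by (cases "x = 0") (auto simp: compose_def t_apply houghton_h_def)
    qed
    finally show ?case .
  qed
  from this[of "nat (m - k + 1)"] have "houghton_h k m \<in> H" if "k \<le> m"
    using that by simp
  moreover have "houghton_h k m \<in> H" if "\<not> k \<le> m"
  proof -
    have "houghton_h k m = \<one>\<^bsub>?B\<^esub>" using that by (auto simp: houghton_h_def BijGroup_def fun_eq_iff)
    then show ?thesis using subgroup.one_closed[OF sg] by simp
  qed
  ultimately show ?thesis by (auto simp: houghton2_def H_def)
qed

lemma houghton_h_neq_one:
  assumes "1 \<le> k" "k \<le> m"
  shows "houghton_h k m \<noteq> \<one>\<^bsub>houghton2\<^esub>"
proof
  assume "houghton_h k m = \<one>\<^bsub>houghton2\<^esub>"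
  then have "houghton_h k m k = k"
    using assms by (simp add: houghton2_def BijGroup_def)
  then show False using assms by (simp add: houghton_h_def)
qed

end

theory Submission
  imports Defs
begin

text \<open>A word in the generators is a walk on the gaps of \<open>\<int>\<close>: \<open>s\<close> and its inverse move a head
  between adjacent gaps, \<open>\<sigma>\<close> swaps the two tokens next to the head. A word of length less than
  \<open>k\<close> permutes only tokens that \<open>h\<^bsub>k,m\<^esub>\<close> fixes, so conjugating \<open>h\<^bsub>k,m\<^esub>\<close> by it amounts to
  conjugating by the power \<open>s ^ n\<close> given by the net displacement of the head, which just moves
  the base point of the closed walk to the gap \<open>n\<close>. An optimal closed walk for
  \<open>h\<^bsub>k,m\<^esub>\<close> runs to the far left, exchanges the pairs \<open>(-l, l)\<close> for \<open>l = m, \<dots>, k\<close> and runs back, so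
  both of its ends can be shortened by \<open>\<bar>n\<bar>\<close>; its mirror image serves \<open>n > 0\<close>.
  Optimality: the swaps are bounded below by the inversions. For the moves, every visit of the
  head beyond a place lets at most one token pass that place, and the very first visit
  beyond either of the places \<open>x\<close>, \<open>-x\<close> brings none of the tokens that have to get there,
  since these still wait on the opposite side.\<close>

section \<open>Words acting on the integers\<close>

text \<open>The nonzero integers are identified with all integers by lowering the positive ones by one.
  Then \<open>s\<close> is the translation by one and \<open>\<sigma>\<close> transposes \<open>-1\<close> and \<open>0\<close>; gap \<open>n\<close> lies between the
  places \<open>n - 1\<close> and \<open>n\<close>.\<close>

datatype letter = Fwd | Bwd | Swap

fun letter_act :: "letter \<Rightarrow> int \<Rightarrow> int" where
  "letter_act Fwd = (\<lambda>x. x + 1)"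
| "letter_act Bwd = (\<lambda>x. x - 1)"
| "letter_act Swap = transpose (-1) 0"

fun word_act :: "letter list \<Rightarrow> int \<Rightarrow> int" where
  "word_act [] = id"
| "word_act (a # as) = letter_act a \<circ> word_act as"

fun step :: "letter \<Rightarrow> int" where
  "step Fwd = 1"
| "step Bwd = -1"
| "step Swap = 0"

definition net :: "letter list \<Rightarrow> int" where
  "net as = sum_list (map step as)"

lemma net_simps [simp]: "net [] = 0" "net (a # as) = step a + net as"
  by (simp_all add: net_def)

lemma word_act_append: "word_act (as @ bs) = word_act as \<circ> word_act bs"
  by (induction as) (simp_all add: comp_assoc)

lemma bij_word_act: "bij (word_act as)"
proof (induction as)
  case Nil
  show ?case by (simp only: word_act.simps bij_id)
next
  case (Cons a as)
  have "bij (letter_act a)"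
    by (cases a) (auto intro: bij_betw_byWitness[where f' = "\<lambda>x. x - 1"]
      bij_betw_byWitness[where f' = "\<lambda>x. x + 1"])
  then show ?case using Cons by (simp only: word_act.simps bij_comp)
qed

lemma word_act_replicate:
  "word_act (replicate c Fwd) x = x + int c"
  "word_act (replicate c Bwd) x = x - int c"
  by (induction c) simp_all

text \<open>Each letter shifts the frame by at most one, so all swaps happen within
  \<open>length as\<close> of the origin; points landing outside are only translated.\<close>

lemma word_act_far:
  "y \<ge> int (length as) \<or> y < - int (length as) \<Longrightarrow> word_act as (y - net as) = y"
proof (induction as arbitrary: y)
  case (Cons a as)
  show ?case
  proof (cases a)
    case Fwd
    then show ?thesis using Cons.IH[of "y - 1"] Cons.prems by (auto simp: algebra_simps)
  next
    case Bwd
    then show ?thesis using Cons.IH[of "y + 1"] Cons.prems by (auto simp: algebra_simps)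
  next
    case Swap
    then show ?thesis using Cons.IH[of y] Cons.prems by (auto simp: transpose_def)
  qed
qed simp

lemma abs_net_le: "\<bar>net as\<bar> \<le> int (length as)"
proof (induction as)
  case (Cons a as)
  then show ?case by (cases a) auto
qed simp

text \<open>The permutation \<open>h\<^bsub>K+1,M+1\<^esub>\<close> in the new coordinates.\<close>

definition flip :: "nat \<Rightarrow> nat \<Rightarrow> int \<Rightarrow> int" where
  "flip K M x = (if int K \<le> x \<and> x \<le> int M \<or> int K \<le> - 1 - x \<and> - 1 - x \<le> int M
     then - 1 - x else x)"

lemma flip_flip [simp]: "flip K M (flip K M x) = x"
  by (auto simp: flip_def)

lemma flip_Suc:
  assumes "K \<le> Suc M"
  shows "flip K (Suc M) y = transpose (- 1 - int (Suc M)) (int (Suc M)) (flip K M y)"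
proof -
  consider "y = int (Suc M)" | "y = - 1 - int (Suc M)"
    | "y \<noteq> int (Suc M)" "y \<noteq> - 1 - int (Suc M)" by blast
  then show ?thesis
  proof cases
    case 3
    then have "flip K M y \<noteq> int (Suc M)" "flip K M y \<noteq> - 1 - int (Suc M)"
      by (auto simp: flip_def)
    moreover have "flip K (Suc M) y = flip K M y" using 3 by (auto simp: flip_def)
    ultimately show ?thesis by simp
  qed (use assms in \<open>simp_all add: flip_def\<close>)
qed

text \<open>With its translation removed, the word permutes \<open>[-K, K)\<close> and fixes
  everything else, while the flip fixes \<open>[-K, K)\<close> pointwise. Hence the two commute, and
  only conjugation by a translation remains.\<close>

lemma flip_word_act:
  assumes "length as \<le> K"
  shows "flip K M (word_act as x) = word_act as (flip K M (x + net as) - net as)"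
proof -
  define p where "p y = word_act as (y - net as)" for y
  have far: "p y = y" if "y \<ge> int K \<or> y < - int K" for y
    using that word_act_far[of as y] assms by (auto simp: p_def)
  have inj: "y = z" if "p y = p z" for y z
    using injD[OF bij_is_inj[OF bij_word_act[of as]], of "y - net as" "z - net as"] that
    by (simp add: p_def)
  have "flip K M (p y) = p (flip K M y)" for y
  proof (cases "y \<ge> int K \<or> y < - int K")
    case True
    then have "flip K M y \<ge> int K \<or> flip K M y < - int K"
      by (auto simp: flip_def)
    then have "p (flip K M y) = flip K M y" by (rule far)
    then show ?thesis using far[OF True] by simp
  next
    case False
    have "\<not> (p y \<ge> int K \<or> p y < - int K)"
    proof
      assume "p y \<ge> int K \<or> p y < - int K"
      then have "p (p y) = p y" by (rule far)
      then have "p y = y" by (rule inj)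
      then show False using False \<open>p y \<ge> int K \<or> p y < - int K\<close> by simp
    qed
    then have "flip K M (p y) = p y" by (auto simp: flip_def)
    moreover have "flip K M y = y" using False by (auto simp: flip_def)
    ultimately show ?thesis by simp
  qed
  from this[of "x + net as"] show ?thesis by (simp add: p_def)
qed

section \<open>Short words for conjugates of the flip\<close>

text \<open>The pair at level \<open>l\<close> costs \<open>4 * l + 1\<close> swaps and
  \<open>4 * l\<close> moves; \<open>2 * M\<close> accounts for the walk to the far end and
  back.\<close>

definition flip_length :: "nat \<Rightarrow> nat \<Rightarrow> nat" where
  "flip_length K M = (\<Sum>l=K..M. 8 * l + 1) + 2 * M"

text \<open>Conjugation by \<open>Fwd\<close> turns the transposition of \<open>-1\<close> and
  \<open>c\<close> into that of \<open>0\<close> and \<open>c + 1\<close>; conjugation by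
  \<open>Swap\<close> then replaces \<open>0\<close> by \<open>-1\<close>.\<close>

fun transpose_word :: "nat \<Rightarrow> letter list" where
  "transpose_word 0 = [Swap]"
| "transpose_word (Suc c) = Swap # Fwd # transpose_word c @ [Bwd, Swap]"

lemma length_transpose_word: "length (transpose_word c) = 4 * c + 1"
  by (induction c) simp_all

lemma word_act_transpose_word: "word_act (transpose_word c) = transpose (-1) (int c)"
  by (induction c) (auto simp: word_act_append fun_eq_iff transpose_def)

text \<open>A walk from gap \<open>- (K + d)\<close> to gap \<open>- K\<close>. Seen from gap
  \<open>- l\<close>, the places \<open>- 1 - l\<close> and \<open>l\<close> have coordinates
  \<open>-1\<close> and \<open>2 * l\<close>.\<close>

fun flip_word :: "nat \<Rightarrow> nat \<Rightarrow> letter list" where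
  "flip_word K 0 = transpose_word (2 * K)"
| "flip_word K (Suc d) = transpose_word (2 * (K + d + 1)) @ Fwd # flip_word K d"

lemma length_flip_word: "length (flip_word K d) = (\<Sum>l=K..K+d. 8 * l + 1) + d"
  by (induction d) (simp_all add: length_transpose_word)

lemma word_act_flip_word:
  "word_act (flip_word K d) x = flip K (K + d) (x - int K) + int (K + d)"
proof (induction d arbitrary: x)
  case 0
  show ?case by (auto simp: word_act_transpose_word transpose_def flip_def)
next
  case (Suc d)
  define N where "N = int (Suc (K + d))"
  have "transpose (- 1) (2 * N) (z + N) = transpose (- 1 - N) N z + N" for z
    by (auto simp: transpose_def)
  from this[of "flip K (K + d) (x - int K)"] show ?case
    using flip_Suc[of K "K + d" "x - int K"] Suc[of x]
    by (simp add: word_act_append word_act_transpose_word N_def algebra_simps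
      del: transpose_word.simps)
qed

lemma ex_word_conj_flip_neg:
  assumes "j \<le> K" "K \<le> M"
  obtains as where "length as + 2 * j = flip_length K M"
    "\<And>x. word_act as x = flip K M (x - int j) + int j"
proof -
  \<comment> \<open>From gap \<open>- j\<close> walk to gap \<open>- M\<close>, run
    \<open>flip_word\<close>, and return from gap \<open>- K\<close>: both outer walks save
    \<open>j\<close> moves.\<close>
  define as where "as = replicate (M - j) Bwd @ flip_word K (M - K) @ replicate (K - j) Fwd"
  have "length as + 2 * j = flip_length K M"
    using assms by (simp add: as_def length_flip_word flip_length_def)
  moreover have "word_act as x = flip K M (x - int j) + int j" for x
    using assms by (simp add: as_def word_act_append word_act_replicate word_act_flip_word of_nat_diff)
  ultimately show ?thesis by (rule that)
qed

fun mirror :: "letter \<Rightarrow> letter" where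
  "mirror Fwd = Bwd"
| "mirror Bwd = Fwd"
| "mirror Swap = Swap"

lemma word_act_mirror: "word_act (map mirror as) x = - 1 - word_act as (- 1 - x)"
proof (induction as)
  case (Cons a as)
  then show ?case by (cases a) (auto simp: transpose_def)
qed simp

lemma ex_word_conj_flip:
  assumes "\<bar>n\<bar> \<le> int K" "K \<le> M"
  obtains as where "int (length as) + 2 * \<bar>n\<bar> = int (flip_length K M)"
    "\<And>x. word_act as x = flip K M (x + n) - n"
proof -
  obtain as where as: "length as + 2 * nat \<bar>n\<bar> = flip_length K M"
    "\<And>x. word_act as x = flip K M (x - int (nat \<bar>n\<bar>)) + int (nat \<bar>n\<bar>)"
  proof -
    have "nat \<bar>n\<bar> \<le> K" using assms(1) by simp
    then show ?thesis using ex_word_conj_flip_neg[of "nat \<bar>n\<bar>" K M] assms(2) that by blast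
  qed
  show ?thesis
  proof (cases "n \<le> 0")
    case True
    then show ?thesis using as by (intro that[of as]) auto
  next
    case False
    \<comment> \<open>The flip commutes with the reflection \<open>- 1 - x\<close>, so the mirrored
      word serves the opposite displacement.\<close>
    have "word_act (map mirror as) x = flip K M (x + n) - n" for x
      using False by (auto simp: word_act_mirror as(2) flip_def)
    then show ?thesis using as(1) False by (intro that[of "map mirror as"]) auto
  qed
qed

lemma ex_word_flip:
  assumes "K \<le> M"
  obtains as where "word_act as = flip K M"
proof -
  have "\<bar>0::int\<bar> \<le> int K" by simp
  from ex_word_conj_flip[OF this assms] obtain as
    where "\<And>x. word_act as x = flip K M (x + 0) - 0" by blast
  then have "word_act as = flip K M" by (simp add: fun_eq_iff)
  then show ?thesis by (rule that)
qed

section \<open>Lower bound for the length of the flip\<close>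

text \<open>Where each token goes while the word is read with the head starting at gap \<open>n\<close>.\<close>

fun token_map :: "int \<Rightarrow> letter list \<Rightarrow> int \<Rightarrow> int" where
  "token_map n [] = id"
| "token_map n (Swap # as) = token_map n as \<circ> transpose (n - 1) n"
| "token_map n (a # as) = token_map (n + step a) as"

text \<open>Tokens are followed from the first letter on, whereas \<open>word_act\<close> applies
  the last letter first; so, up to translations, the token map inverts the action.\<close>

lemma token_map_word_act: "token_map n as (word_act as x + n) = x + n + net as"
proof (induction as arbitrary: n)
  case (Cons a as)
  show ?case
  proof (cases a)
    case Swap
    have "transpose (n - 1) n (transpose (-1) 0 y + n) = y + n" for y
      by (auto simp: transpose_def)
    then show ?thesis using Swap Cons by simp
  qed (use Cons[of "n + step a"] in \<open>simp_all add: algebra_simps\<close>)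
qed simp

lemma token_map_eq_flip:
  assumes "word_act as = flip K M"
  shows "net as = 0" "token_map 0 as = flip K M"
proof -
  \<comment> \<open>So far to the right that the word merely translates and the flip does
    nothing.\<close>
  define y where "y = int (length as) + int M + int K + \<bar>net as\<bar> + 1"
  have "word_act as (y - net as) = y"
    by (rule word_act_far) (auto simp: y_def)
  moreover have "flip K M (y - net as) = y - net as"
    by (auto simp: flip_def y_def)
  ultimately show net: "net as = 0" using assms by simp
  show "token_map 0 as = flip K M"
    using token_map_word_act[of 0 as "flip K M x" for x] assms net by (auto simp: fun_eq_iff)
qed

section \<open>Inversions and the number of swaps\<close>

definition swaps :: "letter list \<Rightarrow> nat" where
  "swaps as = count_list as Swap"

lemma card_le_Suc_of_subset_insert:
  assumes "A \<subseteq> insert a B" "finite B"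
  shows "card A \<le> card B + 1"
  using card_mono[OF _ assms(1)] assms(2) card_insert_le_m1[of "card B + 1" B a]
  by (auto simp: card_insert_if split: if_splits)

text \<open>\<open>t\<close> records the current places of the tokens. A swap can newly invert only
  the pair of tokens on its two neighbouring places.\<close>

lemma card_inversions_le:
  assumes "finite P" "inj t"
  shows "card {(a, b) \<in> P. token_map n as (t a) > token_map n as (t b)}
    \<le> card {(a, b) \<in> P. t a > t b} + swaps as"
  using assms(2)
proof (induction as arbitrary: n t)
  case (Cons a as)
  show ?case
  proof (cases a)
    case Swap
    let ?t = "transpose (n - 1) n \<circ> t"
    have inj: "inj ?t" using Cons.prems by (intro inj_compose) simp_all
    have "{(a, b) \<in> P. ?t a > ?t b}
        \<subseteq> insert (inv_into UNIV t (n - 1), inv_into UNIV t n) {(a, b) \<in> P. t a > t b}"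
    proof
      fix p assume "p \<in> {(a, b) \<in> P. ?t a > ?t b}"
      then obtain a b where p: "p = (a, b)" "(a, b) \<in> P" "?t a > ?t b" by auto
      have "t a > t b \<or> t a = n - 1 \<and> t b = n"
        using p(3) by (auto simp: transpose_def split: if_splits)
      then show "p \<in> insert (inv_into UNIV t (n - 1), inv_into UNIV t n) {(a, b) \<in> P. t a > t b}"
        using p Cons.prems inv_f_f by (metis (mono_tags, lifting) case_prodI insertCI mem_Collect_eq)
    qed
    then have "card {(a, b) \<in> P. ?t a > ?t b} \<le> card {(a, b) \<in> P. t a > t b} + 1"
      by (rule card_le_Suc_of_subset_insert) (auto intro: finite_subset[OF _ assms(1)])
    then show ?thesis using Cons.IH[OF inj, of n] Swap by (simp add: swaps_def)
  qed (use Cons.IH[OF Cons.prems] in \<open>simp_all add: swaps_def\<close>)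
qed (simp add: swaps_def)

lemma swaps_flip_ge:
  assumes "word_act as = flip K M"
  shows "(\<Sum>l=K..M. 4 * l + 1) \<le> swaps as"
proof -
  \<comment> \<open>The inversions whose outermost token starts on \<open>- 1 - l\<close> or
    \<open>l\<close>. The pair \<open>(- 1 - l, l)\<close> itself is listed only in the first
    product, which gives \<open>(2 * l + 1) + 2 * l\<close>.\<close>
  define Q :: "nat \<Rightarrow> (int \<times> int) set" where
    "Q l = {- 1 - int l} \<times> {- int l..int l} \<union> {- int l..<int l} \<times> {int l}" for l
  define P where "P = (\<Union>l\<in>{K..M}. Q l)"
  have fin: "finite P" by (auto simp: P_def Q_def)
  have card_Q: "card (Q l) = 4 * l + 1" for l
  proof -
    have "card (Q l) = card ({- 1 - int l} \<times> {- int l..int l}) + card ({- int l..<int l} \<times> {int l})"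
      unfolding Q_def by (rule card_Un_disjoint) auto
    then show ?thesis by (simp add: card_cartesian_product)
  qed
  have "card P = (\<Sum>l=K..M. card (Q l))"
    unfolding P_def by (rule card_UN_disjoint) (auto simp: Q_def)
  also have "\<dots> = (\<Sum>l=K..M. 4 * l + 1)" by (simp add: card_Q)
  finally have "card P = (\<Sum>l=K..M. 4 * l + 1)" .
  moreover have "flip K M a > flip K M b \<and> a < b" if ab: "(a, b) \<in> P" for a b
  proof -
    obtain l where l: "K \<le> l" "l \<le> M" "(a, b) \<in> Q l"
      using ab by (auto simp: P_def)
    then consider "a = - 1 - int l" "- int l \<le> b" "b \<le> int l"
      | "b = int l" "- int l \<le> a" "a < int l"
      by (auto simp: Q_def)
    then show ?thesis
    proof cases
      case 1
      then have "flip K M a = int l" using l by (simp add: flip_def)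
      moreover have "flip K M b < int l" using 1 l by (cases "b = int l") (auto simp: flip_def)
      ultimately show ?thesis using 1 by simp
    next
      case 2
      then have "flip K M b = - 1 - int l" using l by (simp add: flip_def)
      moreover have "flip K M a > - 1 - int l" using 2 by (simp add: flip_def)
      ultimately show ?thesis using 2 by simp
    qed
  qed
  then have "{(a, b) \<in> P. flip K M a > flip K M b} = P" "{(a, b) \<in> P. id a > id b} = {}"
    by fastforce+
  ultimately show ?thesis
    using card_inversions_le[OF fin inj_on_id, of 0 as] token_map_eq_flip(2)[OF assms]
    by (simp only: id_apply card.empty add_0)
qed

section \<open>Outward crossings and the number of moves\<close>

text \<open>The number of moves away from the origin across the place \<open>x\<close> or \<open>-1 - x\<close>.\<close>

fun outs :: "int \<Rightarrow> int \<Rightarrow> letter list \<Rightarrow> nat" where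
  "outs x n [] = 0"
| "outs x n (a # as) =
    (if a = Fwd \<and> n = x \<or> a = Bwd \<and> n = - x then 1 else 0) + outs x (n + step a) as"

text \<open>Every move changes the distance of the head from gap \<open>0\<close> by one, so inward
  and outward moves balance up to the change of that distance. An outward move is counted for at
  most one \<open>x\<close>, the distance itself.\<close>

lemma length_ge_outs:
  "int (length as) + \<bar>n + net as\<bar> \<ge> int (swaps as) + 2 * (\<Sum>x<c. int (outs (int x) n as)) + \<bar>n\<bar>"
proof (induction as arbitrary: n)
  case (Cons a as)
  define b where "b x = (if a = Fwd \<and> n = int x \<or> a = Bwd \<and> n = - int x then 1::int else 0)" for x
  have "(\<Sum>x<c. int (outs (int x) n (a # as)))
      = (\<Sum>x<c. b x) + (\<Sum>x<c. int (outs (int x) (n + step a) as))"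
    by (simp add: b_def sum.distrib[symmetric] if_distrib[of int] cong: if_cong)
  moreover have "(\<Sum>x<c. b x) \<le> (if a = Fwd \<and> n \<ge> 0 \<or> a = Bwd \<and> n \<le> 0 then 1 else 0)"
  proof -
    have "(\<Sum>x<c. b x) \<le> (\<Sum>x<c. if x = nat \<bar>n\<bar> then
        (if a = Fwd \<and> n \<ge> 0 \<or> a = Bwd \<and> n \<le> 0 then 1 else 0) else 0)"
      by (rule sum_mono) (auto simp: b_def)
    then show ?thesis by (auto simp: split: if_splits)
  qed
  ultimately show ?case using Cons[of "n + step a"]
    by (cases a) (auto simp: swaps_def algebra_simps split: if_splits)
qed (simp add: swaps_def)

text \<open>While the head is beyond the place \<open>x\<close> (or \<open>-1 - x\<close>), the token on that place counts as
  having passed it: this makes the number of passed tokens invariant under swaps.\<close>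

definition passed :: "int \<Rightarrow> int set \<Rightarrow> int set \<Rightarrow> int \<Rightarrow> (int \<Rightarrow> int) \<Rightarrow> nat" where
  "passed x A B n t = card {a \<in> A. t a > x \<or> n > x \<and> t a = x}
     + card {b \<in> B. t b < - 1 - x \<or> n < - x \<and> t b = - 1 - x}"

text \<open>The place \<open>x\<close> belongs to the outside exactly when the head is beyond it, so
  both swapped places lie on the same side of the boundary; likewise at
  \<open>- 1 - x\<close>.\<close>

lemma passed_swap:
  assumes "x \<ge> 0"
  shows "passed x A B n (transpose (n - 1) n \<circ> t) = passed x A B n t"
proof -
  have "transpose (n - 1) n y > x \<or> n > x \<and> transpose (n - 1) n y = x
      \<longleftrightarrow> y > x \<or> n > x \<and> y = x" for y
    by (auto simp: transpose_def)
  moreover have "transpose (n - 1) n y < - 1 - x \<or> n < - x \<and> transpose (n - 1) n y = - 1 - x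
      \<longleftrightarrow> y < - 1 - x \<or> n < - x \<and> y = - 1 - x" for y
    by (auto simp: transpose_def)
  ultimately show ?thesis unfolding passed_def comp_def by presburger
qed

text \<open>A boundary shifts only when the head crosses its place, and an outward crossing adds at
  most the token standing there.\<close>

lemma passed_move:
  assumes "inj t" "finite A" "finite B" "x \<ge> 0"
  shows "passed x A B (n + step a) t
    \<le> passed x A B n t + (if a = Fwd \<and> n = x \<or> a = Bwd \<and> n = - x then 1 else 0)"
proof -
  let ?R = "\<lambda>n. {a \<in> A. t a > x \<or> n > x \<and> t a = x}"
  let ?L = "\<lambda>n. {b \<in> B. t b < - 1 - x \<or> n < - x \<and> t b = - 1 - x}"
  have fin: "finite (?R n)" "finite (?L n)" using assms(2,3) by auto
  have R: "card (?R (n + step a)) \<le> card (?R n) + (if a = Fwd \<and> n = x then 1 else 0)"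
  proof (cases "a = Fwd \<and> n = x")
    case True
    then have "?R (n + step a) \<subseteq> insert (inv_into UNIV t x) (?R n)"
      using assms(1) by (auto simp: inv_f_f)
    then show ?thesis using True card_le_Suc_of_subset_insert[OF _ fin(1)] by auto
  next
    case False
    then have "?R (n + step a) \<subseteq> ?R n" by (cases a) auto
    then show ?thesis using False card_mono[OF fin(1)] by auto
  qed
  have L: "card (?L (n + step a)) \<le> card (?L n) + (if a = Bwd \<and> n = - x then 1 else 0)"
  proof (cases "a = Bwd \<and> n = - x")
    case True
    then have "?L (n + step a) \<subseteq> insert (inv_into UNIV t (- 1 - x)) (?L n)"
      using inv_f_f[OF assms(1)] by (auto simp: eq_commute[of "t _"])
    then show ?thesis using True card_le_Suc_of_subset_insert[OF _ fin(2)] by auto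
  next
    case False
    then have "?L (n + step a) \<subseteq> ?L n" by (cases a) auto
    then show ?thesis using False card_mono[OF fin(2)] by auto
  qed
  show ?thesis using R L unfolding passed_def by (auto split: if_splits)
qed

lemma passed_le:
  assumes "inj t" "finite A" "finite B" "x \<ge> 0"
  shows "passed x A B (n + net as) (token_map n as \<circ> t) \<le> passed x A B n t + outs x n as"
  using assms(1)
proof (induction as arbitrary: n t)
  case (Cons a as)
  show ?case
  proof (cases "a = Swap")
    case True
    have "inj (transpose (n - 1) n \<circ> t)" using Cons.prems by (intro inj_compose) simp_all
    from Cons.IH[OF this, of n] show ?thesis
      using True passed_swap[OF assms(4), of A B n t] by (simp add: comp_assoc del: comp_apply)
  next
    case False
    then have "token_map n (a # as) = token_map (n + step a) as" by (cases a) auto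
    then show ?thesis
      using Cons.IH[OF Cons.prems, of "n + step a"] passed_move[OF Cons.prems assms(2-4), of n a]
      by (auto simp: algebra_simps)
  qed
qed simp

lemma passed_eq_0:
  assumes "x \<ge> 0" "\<And>a. a \<in> A \<Longrightarrow> t a < - 1 - x" "\<And>b. b \<in> B \<Longrightarrow> t b > x"
  shows "passed x A B n t = 0"
proof -
  have "{a \<in> A. t a > x \<or> n > x \<and> t a = x} = {}" using assms(1,2) by force
  moreover have "{b \<in> B. t b < - 1 - x \<or> n < - x \<and> t b = - 1 - x} = {}"
    using assms(1,3) by force
  ultimately show ?thesis unfolding passed_def by (simp only: card.empty add_0)
qed

text \<open>Before the first outward move the swaps touch only places from \<open>- 1 - x\<close> to
  \<open>x\<close>, so every token still waits. That move is counted by \<open>outs\<close> but lets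
  no token pass; it must occur, since some token has passed in the end.\<close>

lemma passed_less:
  assumes "inj t" "finite A" "finite B" "x \<ge> 0"
    and "- x \<le> n" "n \<le> x"
    and "\<And>a. a \<in> A \<Longrightarrow> t a < - 1 - x" "\<And>b. b \<in> B \<Longrightarrow> t b > x"
    and "passed x A B (n + net as) (token_map n as \<circ> t) > 0"
  shows "passed x A B (n + net as) (token_map n as \<circ> t) < outs x n as"
  using assms(1,5-9)
proof (induction as arbitrary: n t)
  case Nil
  then show ?case using passed_eq_0[OF assms(4) Nil.prems(4,5)] by simp
next
  case (Cons a as)
  note waiting = Cons.prems(4,5)
  show ?case
  proof (cases "a = Swap")
    case True
    have "inj (transpose (n - 1) n \<circ> t)" using Cons.prems(1) by (intro inj_compose) simp_all
    moreover have "(transpose (n - 1) n \<circ> t) a < - 1 - x" if "a \<in> A" for a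
      using waiting(1)[OF that] Cons.prems(2,3) by (auto simp: transpose_def)
    moreover have "(transpose (n - 1) n \<circ> t) b > x" if "b \<in> B" for b
      using waiting(2)[OF that] Cons.prems(2,3) by (auto simp: transpose_def)
    ultimately show ?thesis
      using Cons.IH[of "transpose (n - 1) n \<circ> t" n] Cons.prems(2,3,6) True
      by (simp add: comp_def)
  next
    case False
    then have tm: "token_map n (a # as) = token_map (n + step a) as" by (cases a) auto
    show ?thesis
    proof (cases "a = Fwd \<and> n = x \<or> a = Bwd \<and> n = - x")
      case True
      have "passed x A B (n + step a) t = 0"
        by (rule passed_eq_0[OF assms(4) waiting])
      then show ?thesis
        using passed_le[OF Cons.prems(1) assms(2-4), of "n + step a" as] True tm
        by (auto simp: algebra_simps simp del: comp_apply)
    next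
      case out: False
      have "- x \<le> n + step a" "n + step a \<le> x"
        using False out Cons.prems(2,3) by (cases a; auto)+
      with Cons.IH[OF Cons.prems(1) _ _ waiting, of "n + step a"] Cons.prems(6) out tm
      show ?thesis by (auto simp: algebra_simps)
    qed
  qed
qed

lemma outs_flip_ge:
  assumes "word_act as = flip K M" "x < M" "K \<le> M"
  shows "2 * card {l \<in> {K..M}. x < l} + 1 \<le> outs (int x) 0 as"
proof -
  let ?l = "{l \<in> {K..M}. x < l}"
  \<comment> \<open>The tokens of the levels above \<open>x\<close>: those in \<open>A\<close> have
    to get from the far left to the far right, those in \<open>B\<close> the other way.\<close>
  define A where "A = (\<lambda>l. - 1 - int l) ` ?l"
  define B where "B = int ` ?l"
  have card: "card A = card ?l" "card B = card ?l"
    unfolding A_def B_def by (auto intro!: card_image inj_onI)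
  have "{a \<in> A. flip K M a > int x} = A" "{b \<in> B. flip K M b < - 1 - int x} = B"
    by (auto simp: A_def B_def flip_def)
  then have passed: "passed (int x) A B 0 (flip K M) = 2 * card ?l"
    using card by (simp add: passed_def)
  have "M \<in> ?l" using assms(2,3) by simp
  then have "card ?l > 0" by (auto simp: card_gt_0_iff)
  moreover have "finite A" "finite B" "\<And>a. a \<in> A \<Longrightarrow> a < - 1 - int x" "\<And>b. b \<in> B \<Longrightarrow> b > int x"
    by (auto simp: A_def B_def)
  ultimately show ?thesis
    using passed_less[of id A B "int x" 0 as] passed token_map_eq_flip[OF assms(1)] by simp
qed

lemma flip_length_le:
  assumes "word_act as = flip K M" "K \<le> M"
  shows "flip_length K M \<le> length as"
proof -
  \<comment> \<open>Double counting of the pairs \<open>x < l\<close>: each level \<open>l\<close>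
    contributes \<open>l\<close>.\<close>
  have "(\<Sum>x<M. card {l \<in> {K..M}. x < l}) = (\<Sum>x<M. \<Sum>l=K..M. if x < l then 1 else 0)"
    by (simp add: sum.If_cases Int_def)
  also have "\<dots> = (\<Sum>l=K..M. \<Sum>x<M. if x < l then 1 else 0)" by (rule sum.swap)
  also have "\<dots> = (\<Sum>l=K..M. l)"
  proof (rule sum.cong)
    fix l assume "l \<in> {K..M}"
    then have "{..<M} \<inter> {x. x < l} = {..<l}" by auto
    then show "(\<Sum>x<M. if x < l then 1 else 0) = l" by (simp add: sum.If_cases)
  qed simp
  finally have "(\<Sum>x<M. 2 * card {l \<in> {K..M}. x < l} + 1) = 2 * (\<Sum>l=K..M. l) + M"
    by (simp only: sum.distrib sum_distrib_left[symmetric]) simp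
  moreover have "(\<Sum>x<M. 2 * card {l \<in> {K..M}. x < l} + 1) \<le> (\<Sum>x<M. outs (int x) 0 as)"
    using outs_flip_ge[OF assms(1) _ assms(2)] by (intro sum_mono) auto
  ultimately have outs: "2 * (\<Sum>l=K..M. l) + M \<le> (\<Sum>x<M. outs (int x) 0 as)" by simp
  \<comment> \<open>The factor 2 pairs each outward move with an inward one; the extra crossing for
    each \<open>x < M\<close> yields the summand \<open>2 * M\<close>.\<close>
  have "flip_length K M = (\<Sum>l=K..M. 4 * l + 1) + 2 * (2 * (\<Sum>l=K..M. l) + M)"
    by (simp add: flip_length_def sum_distrib_left sum.distrib[symmetric])
  also have "\<dots> \<le> swaps as + 2 * (\<Sum>x<M. outs (int x) 0 as)"
    by (intro add_mono mult_le_mono2 swaps_flip_ge[OF assms(1)] outs)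
  also have "\<dots> \<le> length as"
    using length_ge_outs[where as = as and n = 0 and c = M] token_map_eq_flip(1)[OF assms(1)]
    by (simp flip: of_nat_sum)
  finally show ?thesis .
qed

section \<open>Transfer to Houghton's group\<close>

definition lower :: "int \<Rightarrow> int" where
  "lower x = (if x > 0 then x - 1 else x)"

definition raise :: "int \<Rightarrow> int" where
  "raise y = (if y \<ge> 0 then y + 1 else y)"

definition transfer :: "(int \<Rightarrow> int) \<Rightarrow> int \<Rightarrow> int" where
  "transfer f = (\<lambda>x\<in>nonzero_ints. raise (f (lower x)))"

lemma lower_raise [simp]: "lower (raise y) = y"
  by (simp add: lower_def raise_def)

lemma raise_lower: "x \<noteq> 0 \<Longrightarrow> raise (lower x) = x"
  by (simp add: lower_def raise_def)

lemma raise_neq_0: "raise y \<noteq> 0"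
  by (simp add: raise_def)

lemma transfer_eq_iff: "transfer f = transfer g \<longleftrightarrow> f = g"
proof
  assume eq: "transfer f = transfer g"
  show "f = g"
  proof
    fix y
    have "raise (f y) = raise (g y)"
      using fun_cong[OF eq, of "raise y"] by (simp add: transfer_def raise_neq_0)
    then show "f y = g y" by (metis lower_raise)
  qed
qed simp

lemma transfer_comp: "transfer (f \<circ> g) = compose nonzero_ints (transfer f) (transfer g)"
  by (auto simp: transfer_def compose_def raise_neq_0 fun_eq_iff)

lemma houghton_s_eq: "houghton_s = transfer (letter_act Fwd)"
  by (auto simp: houghton_s_def transfer_def lower_def raise_def fun_eq_iff)

lemma houghton_sigma_eq: "houghton_sigma = transfer (letter_act Swap)"
  by (auto simp: houghton_sigma_def transfer_def lower_def raise_def fun_eq_iff transpose_def)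

lemma houghton_h_eq:
  assumes "1 \<le> k" "1 \<le> m"
  shows "houghton_h k m = transfer (flip (nat (k - 1)) (nat (m - 1)))"
proof
  fix x :: int
  consider "x = 0" | "x > 0" | "x < 0" by linarith
  then show "houghton_h k m x = transfer (flip (nat (k - 1)) (nat (m - 1))) x"
  proof cases
    case 2
    have "\<not> (k \<le> - x \<and> - x \<le> m)" using 2 assms by simp
    then show ?thesis using 2 assms
      by (simp add: houghton_h_def transfer_def lower_def flip_def raise_def)
  next
    case 3
    then show ?thesis using assms
      by (simp add: houghton_h_def transfer_def lower_def flip_def raise_def)
  qed (simp add: houghton_h_def transfer_def)
qed

lemma houghton_gens_carrier: "houghton_gens \<subseteq> carrier houghton2"
  unfolding generate_houghton2[symmetric] by (blast intro: generate.incl)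

lemma houghton2_carrierD:
  assumes "g \<in> carrier houghton2"
  shows "g \<in> Bij nonzero_ints"
proof -
  have "g \<in> generate (BijGroup nonzero_ints) houghton_gens"
    using assms unfolding houghton2_def by simp
  from group.generate_in_carrier[OF group_BijGroup houghton_gens_subset this]
  show ?thesis unfolding BijGroup_def by simp
qed

lemma houghton2_mult:
  assumes "g \<in> carrier houghton2" "g' \<in> carrier houghton2"
  shows "g \<otimes>\<^bsub>houghton2\<^esub> g' = compose nonzero_ints g g'"
  using houghton2_carrierD[OF assms(1)] houghton2_carrierD[OF assms(2)]
  by (simp add: houghton2_def BijGroup_def)

lemma houghton2_one: "\<one>\<^bsub>houghton2\<^esub> = transfer id"
proof -
  have "\<one>\<^bsub>houghton2\<^esub> = (\<lambda>x\<in>nonzero_ints. x)"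
    by (simp add: houghton2_def BijGroup_def)
  also have "\<dots> = transfer id"
    unfolding transfer_def by (rule restrict_ext) (simp add: raise_lower)
  finally show ?thesis .
qed

lemma UNIV_letter: "UNIV = {Fwd, Bwd, Swap}"
proof -
  have "a \<in> {Fwd, Bwd, Swap}" for a by (cases a) auto
  then show ?thesis by blast
qed

lemma transfer_letter_act:
  "transfer (letter_act a) \<in> carrier houghton2"
  "range (\<lambda>a. transfer (letter_act a)) = houghton_gens \<union> m_inv houghton2 ` houghton_gens"
proof -
  interpret G: group houghton2 by (rule group_houghton2)
  have carrier: "houghton_s \<in> carrier houghton2" "houghton_sigma \<in> carrier houghton2"
    using houghton_gens_carrier by (auto simp: houghton_gens_def)
  have s_inv: "inv\<^bsub>houghton2\<^esub> houghton_s \<in> carrier houghton2" using carrier by simp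
  have sB: "transfer (letter_act Bwd) = inv\<^bsub>houghton2\<^esub> houghton_s"
  proof -
    have inv_comp: "compose nonzero_ints (inv\<^bsub>houghton2\<^esub> houghton_s) houghton_s = transfer id"
      using G.l_inv[OF carrier(1)] houghton2_mult[OF s_inv carrier(1)] by (simp add: houghton2_one)
    show ?thesis
    proof
      fix x
      show "transfer (letter_act Bwd) x = (inv\<^bsub>houghton2\<^esub> houghton_s) x"
      proof (cases "x = 0")
        case True
        then show ?thesis using houghton2_carrierD[OF s_inv]
          by (simp add: transfer_def Bij_def extensional_def)
      next
        case False
        \<comment> \<open>The preimage of \<open>x\<close> under \<open>houghton_s\<close>, where
          the inverse law reveals the value of the inverse at \<open>x\<close>.\<close>
        define y where "y = raise (lower x - 1)"
        have y: "y \<noteq> 0" "houghton_s y = x"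
          using False by (simp_all add: y_def houghton_s_eq transfer_def raise_neq_0 raise_lower)
        then show ?thesis using fun_cong[OF inv_comp, of y] False
          by (simp add: compose_def transfer_def y_def raise_lower raise_neq_0)
      qed
    qed
  qed
  have "houghton_sigma \<otimes>\<^bsub>houghton2\<^esub> houghton_sigma = \<one>\<^bsub>houghton2\<^esub>"
    using houghton2_mult[OF carrier(2,2)]
    by (simp add: houghton2_one houghton_sigma_eq transfer_comp[symmetric] transpose_comp_involutory
      del: letter_act.simps(1,2))
  then have sX: "inv\<^bsub>houghton2\<^esub> houghton_sigma = houghton_sigma"
    using carrier by (intro G.inv_equality) auto
  show "transfer (letter_act a) \<in> carrier houghton2"
    using carrier sB by (cases a) (simp_all add: houghton_s_eq houghton_sigma_eq)
  have "range (\<lambda>a. transfer (letter_act a))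
      = {transfer (letter_act Fwd), transfer (letter_act Bwd), transfer (letter_act Swap)}"
    unfolding UNIV_letter by simp
  also have "\<dots> = {houghton_s, inv\<^bsub>houghton2\<^esub> houghton_s, houghton_sigma}"
    unfolding sB houghton_s_eq[symmetric] houghton_sigma_eq[symmetric] ..
  also have "\<dots> = houghton_gens \<union> m_inv houghton2 ` houghton_gens"
    using sX by (auto simp: houghton_gens_def)
  finally show "range (\<lambda>a. transfer (letter_act a))
      = houghton_gens \<union> m_inv houghton2 ` houghton_gens" .
qed

lemma word_prod_letters:
  "word_prod houghton2 (map (\<lambda>a. transfer (letter_act a)) as) = transfer (word_act as)
    \<and> transfer (word_act as) \<in> carrier houghton2"
proof (induction as)
  case Nil
  interpret G: group houghton2 by (rule group_houghton2)
  show ?case using G.one_closed by (simp add: word_prod_def houghton2_one id_def)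
next
  case (Cons a as)
  interpret G: group houghton2 by (rule group_houghton2)
  show ?case
    using Cons transfer_letter_act(1)[of a] houghton2_mult[of "transfer (letter_act a)" "transfer (word_act as)"]
      G.m_closed[of "transfer (letter_act a)" "transfer (word_act as)"]
      transfer_comp[of "letter_act a" "word_act as"]
    by (simp add: word_prod_def comp_def)
qed

section \<open>Word length in terms of letters\<close>

lemma generator_list_iff:
  "set ws \<subseteq> houghton_gens \<union> m_inv houghton2 ` houghton_gens
    \<longleftrightarrow> (\<exists>as. ws = map (\<lambda>a. transfer (letter_act a)) as)"
  unfolding transfer_letter_act(2)[symmetric] ex_map_conv by blast

lemma word_length_transfer:
  "word_length houghton2 houghton_gens (transfer f) = (LEAST n. \<exists>as. length as = n \<and> word_act as = f)"
proof -
  have "(\<exists>ws. length ws = n \<and> (\<exists>as. ws = map (\<lambda>a. transfer (letter_act a)) as)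
        \<and> word_prod houghton2 ws = transfer f)
      \<longleftrightarrow> (\<exists>as. length as = n \<and> word_act as = f)" (is "?l \<longleftrightarrow> ?r") for n
  proof
    assume ?l
    then obtain as where "length as = n" "transfer (word_act as) = transfer f"
      using word_prod_letters by auto
    then show ?r unfolding transfer_eq_iff by blast
  next
    assume ?r
    then obtain as where "length (map (\<lambda>a. transfer (letter_act a)) as) = n" "word_act as = f"
      by auto
    then show ?l using word_prod_letters[of as] by blast
  qed
  then show ?thesis unfolding word_length_def generator_list_iff by simp
qed

text \<open>\<open>LEAST\<close> is attained only if some word exists; \<open>bs\<close> provides
  one.\<close>

lemma ex_shortest_word:
  obtains as where "word_act as = word_act bs"
    "length as = word_length houghton2 houghton_gens (transfer (word_act bs))"
proof -
  have "\<exists>n as. length as = n \<and> word_act as = word_act bs" by blast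
  from LeastI_ex[OF this] show ?thesis
    using that unfolding word_length_transfer[symmetric] by blast
qed

lemma houghton2_word:
  assumes "g \<in> carrier houghton2"
  obtains as where "g = transfer (word_act as)" "length as = word_length houghton2 houghton_gens g"
proof -
  obtain bs where "g = transfer (word_act bs)"
    using ex_word[OF group_houghton2 houghton_gens_carrier, of g] assms word_prod_letters
    unfolding generate_houghton2 generator_list_iff by auto
  then show ?thesis using ex_shortest_word[of bs] that by metis
qed

lemma word_length_le: "word_length houghton2 houghton_gens (transfer (word_act as)) \<le> length as"
proof -
  have "\<exists>bs. length bs = length as \<and> word_act bs = word_act as" by blast
  from Least_le[where P = "\<lambda>n. \<exists>bs. length bs = n \<and> word_act bs = word_act as", OF this]
  show ?thesis by (simp only: word_length_transfer)
qed

lemma word_length_flip_ge: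
  assumes "K \<le> M"
  shows "flip_length K M \<le> word_length houghton2 houghton_gens (transfer (flip K M))"
proof -
  obtain bs where bs: "word_act bs = flip K M" by (rule ex_word_flip[OF assms])
  obtain as where "word_act as = word_act bs"
    "length as = word_length houghton2 houghton_gens (transfer (word_act bs))"
    by (rule ex_shortest_word)
  then show ?thesis using flip_length_le[of as K M] assms bs by simp
qed

text \<open>By \<open>flip_word_act\<close> only the net displacement of the conjugating word
  matters, and \<open>ex_word_conj_flip\<close> supplies a word for that conjugate.\<close>

lemma word_length_conj_flip_le:
  assumes "length as \<le> K" "K \<le> M"
  shows "int (word_length houghton2 houghton_gens
      (inv\<^bsub>houghton2\<^esub> transfer (word_act as) \<otimes>\<^bsub>houghton2\<^esub> transfer (flip K M)
        \<otimes>\<^bsub>houghton2\<^esub> transfer (word_act as)))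
    + 2 * \<bar>net as\<bar> \<le> int (flip_length K M)"
proof -
  interpret G: group houghton2 by (rule group_houghton2)
  have "\<bar>net as\<bar> \<le> int K" using abs_net_le[of as] assms(1) by simp
  from ex_word_conj_flip[OF this assms(2)] obtain bs where bs: "int (length bs) + 2 * \<bar>net as\<bar> = int (flip_length K M)"
    "\<And>x. word_act bs x = flip K M (x + net as) - net as"
    by blast
  obtain hs where hs: "word_act hs = flip K M"
    by (rule ex_word_flip[OF assms(2)])
  let ?w = "transfer (word_act as)" and ?b = "transfer (word_act bs)" and ?h = "transfer (flip K M)"
  have c: "?w \<in> carrier houghton2" "?b \<in> carrier houghton2" "?h \<in> carrier houghton2"
    using word_prod_letters hs[symmetric] by simp_all
  have "flip K M \<circ> word_act as = word_act as \<circ> word_act bs"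
    using flip_word_act[OF assms(1)] by (auto simp: fun_eq_iff bs(2))
  then have "?h \<otimes>\<^bsub>houghton2\<^esub> ?w = ?w \<otimes>\<^bsub>houghton2\<^esub> ?b"
    using c by (simp add: houghton2_mult transfer_comp[symmetric])
  then have "inv\<^bsub>houghton2\<^esub> ?w \<otimes>\<^bsub>houghton2\<^esub> ?h \<otimes>\<^bsub>houghton2\<^esub> ?w = ?b"
    using c by (simp add: G.m_assoc G.inv_solve_left')
  then show ?thesis using bs(1) word_length_le[of bs] by simp
qed

text \<open>The net displacement can be read off from the permutation far from the origin, and a
  letter changes it by at most one.\<close>

lemma word_length_power:
  "word_length houghton2 houghton_gens (transfer (word_act (replicate r Fwd))) = r"
proof (rule antisym)
  show "word_length houghton2 houghton_gens (transfer (word_act (replicate r Fwd))) \<le> r"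
    using word_length_le[of "replicate r Fwd"] by simp
  obtain as where as: "word_act as = word_act (replicate r Fwd)"
    "length as = word_length houghton2 houghton_gens (transfer (word_act (replicate r Fwd)))"
    by (rule ex_shortest_word)
  have "net as = int r"
    using word_act_far[of as "int (length as)"] by (simp add: as(1) word_act_replicate)
  then show "r \<le> word_length houghton2 houghton_gens (transfer (word_act (replicate r Fwd)))"
    using abs_net_le[of as] as(2) by simp
qed

section \<open>The average over the sphere\<close>

theorem theorem3p3:
  fixes k m :: int and r :: nat
  assumes "1 < k" and "k \<le> m"
    and "1 \<le> r" and "int r < k"
  shows "spherical_curvature houghton2 houghton_gens r (houghton_h k m) > 0"
proof -
  define K M where "K = nat (k - 1)" and "M = nat (m - 1)"
  have KM: "K \<le> M" "r \<le> K" using assms by (auto simp: K_def M_def)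
  have h: "houghton_h k m = transfer (flip K M)"
    using houghton_h_eq assms by (simp add: K_def M_def)
  let ?S = "word_sphere houghton2 houghton_gens r"
  let ?len = "word_length houghton2 houghton_gens"
  define c where "c w = ?len (inv\<^bsub>houghton2\<^esub> w \<otimes>\<^bsub>houghton2\<^esub> houghton_h k m \<otimes>\<^bsub>houghton2\<^esub> w)" for w
  define H where "H = ?len (houghton_h k m)"
  have H: "flip_length K M \<le> H"
    unfolding H_def h by (rule word_length_flip_ge[OF KM(1)])
  have "c w \<le> H" if "w \<in> ?S" for w
  proof -
    obtain as where "w = transfer (word_act as)" "length as = r"
      using houghton2_word[of w] \<open>w \<in> ?S\<close> by (auto simp: word_sphere_def)
    then show ?thesis
      using word_length_conj_flip_le[of as K M] KM H by (simp add: c_def h)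
  qed
  \<comment> \<open>The power \<open>s ^ r\<close> has net displacement \<open>r\<close>, which is
    positive, so its conjugate is strictly shorter and the average drops below
    \<open>H\<close>.\<close>
  moreover define s where "s = transfer (word_act (replicate r Fwd))"
  have s: "s \<in> ?S"
    using word_length_power word_prod_letters by (auto simp: word_sphere_def s_def)
  moreover have "c s < H"
  proof -
    have "net (replicate r Fwd) = int r" by (simp add: net_def sum_list_replicate)
    then show ?thesis
      using word_length_conj_flip_le[of "replicate r Fwd" K M] KM H assms(3)
      by (simp add: c_def s_def h)
  qed
  ultimately have "(\<Sum>w\<in>?S. real (c w)) < (\<Sum>w\<in>?S. real H)"
    using finite_houghton_sphere by (intro sum_strict_mono_ex1) auto
  then have lt: "(\<Sum>w\<in>?S. real (c w)) < real (card ?S) * real H" by simp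
  have "real (card ?S) > 0"
    using s finite_houghton_sphere by (auto simp: card_gt_0_iff)
  with lt have "1 / real (card ?S) * (\<Sum>w\<in>?S. real (c w)) < real H"
    by (simp add: divide_less_eq mult.commute)
  moreover have "H > 0" using \<open>c s < H\<close> by simp
  ultimately show ?thesis
    unfolding spherical_curvature_def c_def[symmetric] H_def[symmetric] by simp
qed

end
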